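(* Let $2<p<\infty$, $p'=p/(p-1)$ and $K=(p-1)^p$. Define $B:(0,\infty)^2\to\mathbb{R}$ by $$B(x,z)=\left(1-\frac1p\right)xz\left[\varphi(x^{1-p}z)+\frac{1}{\varphi(x^{1-p}z)-p+2}\right],$$ where, for $s>0$, $\varphi(s)$ is the unique number in $[p-2,\infty)$ satisfying $$p\left(1-\frac1p\right)^{p-1}(1+\varphi(s))^{p-2}(\varphi(s)-p+2)=s.$$ Then $B$ satisfies the following four conditions: 1. $B(x,z)\geq xz$ for all $x,z>0$. 2. $B(x,z)\leq \dfrac{Kx^p}{p}+\dfrac{z^{p'}}{p'}$ for all $x,z>0$. 3. For all $x,z>0$, $$\frac{B_{xx}(x,z)}{|B_{xz}(x,z)|+1}\leq \frac{B_x(x,z)}{x}\quad\text{and}\quad \frac{B_{zz}(x,z)}{|B_{xz}(x,z)|+1}\leq \frac{B_z(x,z)}{z}.$$ 4. For all $x,z>0$ and all $h,k\in\mathbb{R}$, $$B_{xx}(x,z)h^2+2B_{xz}(x,z)hk+B_{zz}(x,z)k^2\geq 2|h||k|.$$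
   Context: Subscripts on $B$ denote partial derivatives. The function $\varphi$ is well defined and smooth on $(0,\infty)$, with $\varphi(s)>p-2$ for $s>0$, because $u\mapsto p(1-1/p)^{p-1}(1+u)^{p-2}(u-p+2)$ is strictly increasing from $0$ to $\infty$ on $[p-2,\infty)$ with positive derivative. With $p^*=\max\{p,p'\}$, one has $K=(p^*-1)^p$. *)

theory Defs
  imports "HOL-Analysis.Analysis"
begin

(* The existence and uniqueness of the number described below hold for p > 2 and s > 0;
   only these arguments are relevant. *)
definition \<phi> :: "real \<Rightarrow> real \<Rightarrow> real" where
  "\<phi> p s = (THE u. u \<in> {p - 2..} \<and>
     p * (1 - 1 / p) powr (p - 1) * (1 + u) powr (p - 2) * (u - p + 2) = s)"

(* Total on the plane, but only its values for x, z > 0 are meaningful; that quadrant is open,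
   so the partial derivatives there do not depend on values elsewhere. *)
definition B :: "real \<Rightarrow> real \<Rightarrow> real \<Rightarrow> real" where
  "B p x z = (1 - 1 / p) * x * z *
     (\<phi> p (x powr (1 - p) * z) + 1 / (\<phi> p (x powr (1 - p) * z) - p + 2))"

definition partial_x :: "(real \<Rightarrow> real \<Rightarrow> real) \<Rightarrow> real \<Rightarrow> real \<Rightarrow> real" where
  "partial_x f x z = deriv (\<lambda>t. f t z) x"

definition partial_z :: "(real \<Rightarrow> real \<Rightarrow> real) \<Rightarrow> real \<Rightarrow> real \<Rightarrow> real" where
  "partial_z f x z = deriv (\<lambda>t. f x t) z"

definition B_x :: "real \<Rightarrow> real \<Rightarrow> real \<Rightarrow> real" where
  "B_x p = partial_x (B p)"

definition B_z :: "real \<Rightarrow> real \<Rightarrow> real \<Rightarrow> real" where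
  "B_z p = partial_z (B p)"

definition B_xx :: "real \<Rightarrow> real \<Rightarrow> real \<Rightarrow> real" where
  "B_xx p = partial_x (B_x p)"

(* Subscripts are read from left to right: first in x, then in z. *)
definition B_xz :: "real \<Rightarrow> real \<Rightarrow> real \<Rightarrow> real" where
  "B_xz p = partial_z (B_x p)"

definition B_zz :: "real \<Rightarrow> real \<Rightarrow> real \<Rightarrow> real" where
  "B_zz p = partial_z (B_z p)"

end

theory Submission
  imports Defs
begin

text \<open>
  Put \<open>u = \<phi> (x\<^sup>1\<^sup>-\<^sup>p z)\<close> and \<open>w = u - p + 2\<close>.  Logarithmic differentiation of the equation for
  \<open>\<phi>\<close> gives \<open>s \<phi>' s = (1 + u) w / ((p - 1) (w + 1))\<close>, and then everything collapses:
  \<open>B\<^sub>x = (p - 1) z / w\<close>, \<open>B\<^sub>z = x u\<close> and \<open>B\<^sub>x\<^sub>z = (p - 2) / (w + 1)\<close>.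
  The first inequality of condition 3 is an equality, and condition 4 holds because
  \<open>B\<^sub>x\<^sub>x B\<^sub>z\<^sub>z = (B\<^sub>x\<^sub>z + 1)\<^sup>2\<close>.  By homogeneity condition 2 reduces to \<open>x = 1\<close>, where the difference of
  the two sides has derivative \<open>z\<^sup>1\<^sup>/\<^sup>(\<^sup>p\<^sup>-\<^sup>1\<^sup>) - \<phi> z\<close>; this changes sign once, at
  \<open>z = (p - 1)\<^sup>p\<^sup>-\<^sup>1\<close>, where the difference vanishes.  Condition 1 is \<open>w + 1 / w \<ge> 2\<close>.
\<close>

section \<open>The equation defining \<open>\<phi>\<close> and its inverse function\<close>

text \<open>Kept literally as in \<open>\<phi>_def\<close>, so that folding exhibits
  \<open>\<phi> p\<close> as the inverse of \<open>phi_inv p\<close> on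
  \<open>{p - 2..}\<close>.\<close>

definition phi_inv :: "real \<Rightarrow> real \<Rightarrow> real" where
  "phi_inv p u = p * (1 - 1 / p) powr (p - 1) * (1 + u) powr (p - 2) * (u - p + 2)"

lemma phi_inv_strict_mono:
  assumes "2 < p" "p - 2 \<le> u" "u < v"
  shows "phi_inv p u < phi_inv p v"
proof -
  have "(1 + u) powr (p - 2) < (1 + v) powr (p - 2)"
    using assms by (intro powr_less_mono2) auto
  then have "(1 + u) powr (p - 2) * (u - p + 2) < (1 + v) powr (p - 2) * (v - p + 2)"
    using assms by (intro mult_strict_mono) auto
  moreover have "0 < p * (1 - 1 / p) powr (p - 1)"
    using assms by simp
  ultimately have "p * (1 - 1 / p) powr (p - 1) * ((1 + u) powr (p - 2) * (u - p + 2))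
      < p * (1 - 1 / p) powr (p - 1) * ((1 + v) powr (p - 2) * (v - p + 2))"
    by (rule mult_strict_left_mono)
  then show ?thesis
    by (simp only: phi_inv_def mult.assoc)
qed

lemma phi_inv_less_iff:
  assumes "2 < p" "p - 2 \<le> u" "p - 2 \<le> v"
  shows "phi_inv p u < phi_inv p v \<longleftrightarrow> u < v"
  using phi_inv_strict_mono[OF assms(1,2), of v] phi_inv_strict_mono[OF assms(1,3), of u]
  by (cases u v rule: linorder_cases) auto

lemma phi_inv_pos:
  assumes "2 < p" "p - 2 < u"
  shows "0 < phi_inv p u"
  using assms by (simp add: phi_inv_def)

text \<open>The factor after \<open>phi_inv p u\<close> is the logarithmic derivative (p - 2)/(1 +
  u) + 1/(u - p + 2). Keeping \<open>phi_inv p u\<close> as a factor lets it become \<open>s\<close>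
  in the inverse function rule and cancel under \<open>ln\<close>.\<close>

lemma phi_inv_has_derivative:
  assumes "2 < p" "p - 2 < u"
  shows "(phi_inv p has_real_derivative
    phi_inv p u * ((p - 1) * (u - p + 3) / ((1 + u) * (u - p + 2)))) (at u)"
proof -
  have pos: "0 < 1 + u" "0 < u - p + 2"
    using assms by auto
  define C where "C = p * (1 - 1 / p) powr (p - 1)"
  define P where "P = (1 + u) powr (p - 2)"
  have "(1 + u) powr (p - 2 - 1) = P / (1 + u)"
    using powr_diff[of "1 + u" "p - 2" 1] pos by (simp add: P_def)
  then have "((\<lambda>u. (1 + u) powr (p - 2)) has_real_derivative (p - 2) * (P / (1 + u))) (at u)"
    using has_real_derivative_powr[OF pos(1), of "p - 2"]
      DERIV_shift[of "\<lambda>y. y powr (p - 2)" _ u 1] by (simp add: add.commute)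
  moreover have "((\<lambda>u. u - p + 2) has_real_derivative 1) (at u)"
    by (auto intro!: derivative_eq_intros)
  ultimately have "(phi_inv p has_real_derivative
      C * ((p - 2) * (P / (1 + u))) * (u - p + 2) + 1 * (C * P)) (at u)"
    unfolding phi_inv_def[abs_def] C_def P_def by (intro DERIV_mult DERIV_cmult)
  also have "C * ((p - 2) * (P / (1 + u))) * (u - p + 2) + 1 * (C * P)
      = C * P * (u - p + 2) * ((p - 1) * (u - p + 3) / ((1 + u) * (u - p + 2)))"
    using pos by (simp add: divide_simps) (simp add: algebra_simps)
  finally show ?thesis
    unfolding phi_inv_def[of p u] C_def P_def .
qed

lemma phi_inv_surj:
  assumes "2 < p" "0 < s"
  shows "\<exists>u\<ge>p - 2. phi_inv p u = s"
proof -
  define C where "C = p * (1 - 1 / p) powr (p - 1)"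
  have C: "0 < C"
    using assms by (simp add: C_def)
  \<comment> \<open>Chosen so that \<open>C * (v - p + 2) = s\<close>; the remaining factor
    \<open>(1 + v) powr (p - 2)\<close> is at least 1.\<close>
  define v where "v = p - 2 + s / C"
  have v: "p - 2 \<le> v"
    using assms C by (simp add: v_def)
  have "1 \<le> (1 + v) powr (p - 2)"
    using assms v by (intro ge_one_powr_ge_zero) auto
  then have "s * 1 \<le> s * (1 + v) powr (p - 2)"
    using assms by (intro mult_left_mono) auto
  also have "\<dots> = phi_inv p v"
    using C by (simp add: phi_inv_def C_def[symmetric] v_def)
  finally have "s \<le> phi_inv p v"
    by simp
  moreover have "phi_inv p (p - 2) \<le> s"
    using assms by (simp add: phi_inv_def)
  moreover have "continuous_on {p - 2..v} (phi_inv p)"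
    unfolding phi_inv_def[abs_def] using assms
    by (intro continuous_intros) auto
  ultimately show ?thesis
    using IVT'[of "phi_inv p" "p - 2" s v] v by auto
qed

lemma phi_phi_inv:
  assumes "2 < p" "p - 2 \<le> u"
  shows "\<phi> p (phi_inv p u) = u"
proof -
  have "v = u" if "p - 2 \<le> v" "phi_inv p v = phi_inv p u" for v
    using that phi_inv_less_iff[OF assms(1)] assms(2) by (metis less_irrefl linorder_neqE_linordered_idom)
  then show ?thesis
    unfolding \<phi>_def phi_inv_def[symmetric] using assms by (intro the_equality) auto
qed

lemma phi_gt:
  assumes "2 < p" "0 < s"
  shows "p - 2 < \<phi> p s"
    and phi_inv_phi: "phi_inv p (\<phi> p s) = s"
proof -
  obtain u where u: "p - 2 \<le> u" "phi_inv p u = s"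
    using phi_inv_surj[OF assms] by blast
  then have "\<phi> p s = u"
    using phi_phi_inv assms by blast
  \<comment> \<open>\<open>phi_inv p\<close> vanishes at \<open>p - 2\<close>, whereas
    \<open>s\<close> is positive. This strictness keeps the later denominators nonzero.\<close>
  moreover have "u \<noteq> p - 2"
    using u(2) assms by (auto simp: phi_inv_def)
  ultimately show "p - 2 < \<phi> p s" "phi_inv p (\<phi> p s) = s"
    using u by auto
qed

lemma phi_le_iff:
  assumes "2 < p" "0 < s" "p - 2 \<le> u"
  shows "\<phi> p s \<le> u \<longleftrightarrow> s \<le> phi_inv p u"
  using phi_inv_less_iff[OF assms(1,3), of "\<phi> p s"] phi_gt[OF assms(1,2)] phi_inv_phi[OF assms(1,2)]
  by (simp add: not_less[symmetric] less_imp_le)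

lemma phi_has_derivative:
  assumes "2 < p" "0 < s"
  shows "(\<phi> p has_real_derivative
    (1 + \<phi> p s) * (\<phi> p s - p + 2) / ((p - 1) * (\<phi> p s - p + 3)) / s) (at s)"
proof -
  define u where "u = \<phi> p s"
  have u: "p - 2 < u" "phi_inv p u = s"
    using phi_gt[OF assms] phi_inv_phi[OF assms] by (auto simp: u_def)
  \<comment> \<open>The inverse function rule requires continuity of \<open>\<phi> p\<close> first.
    The radius, half the distance from \<open>u\<close> to \<open>p - 2\<close>, keeps every
    \<open>v\<close> strictly to the right of \<open>p - 2\<close>.\<close>
  have "isCont (\<phi> p) (phi_inv p u)"
  proof (rule isCont_inverse_function[where f = "phi_inv p" and x = u and d = "(u - p + 2) / 2"])
    fix v assume "\<bar>v - u\<bar> \<le> (u - p + 2) / 2"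
    then have v: "p - 2 < v"
      using u(1) abs_ge_minus_self[of "v - u"] by simp
    show "\<phi> p (phi_inv p v) = v"
      using phi_phi_inv assms(1) v by simp
    show "isCont (phi_inv p) v"
      using phi_inv_has_derivative[OF assms(1) v] DERIV_isCont by blast
  qed (use u(1) in simp)
  moreover have "(phi_inv p has_real_derivative
      s * ((p - 1) * (u - p + 3) / ((1 + u) * (u - p + 2)))) (at (\<phi> p s))"
    using phi_inv_has_derivative[OF assms(1) u(1)] u(2) by (simp add: u_def)
  ultimately have "(\<phi> p has_real_derivative
      inverse (s * ((p - 1) * (u - p + 3) / ((1 + u) * (u - p + 2))))) (at s)"
    using u assms
    by (intro DERIV_inverse_function[where f = "phi_inv p" and a = 0 and b = "s + 1"])
      (auto simp: phi_inv_phi)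
  then show ?thesis
    by (simp add: u_def field_simps)
qed

section \<open>Partial derivatives of \<open>phi_at\<close>\<close>

abbreviation phi_at :: "real \<Rightarrow> real \<Rightarrow> real \<Rightarrow> real" where
  "phi_at p x z \<equiv> \<phi> p (x powr (1 - p) * z)"

lemma phi_at_gt:
  assumes "2 < p" "0 < x" "0 < z"
  shows "p - 2 < phi_at p x z"
  using assms by (intro phi_gt) auto

text \<open>The inner argument s has x-derivative (1 - p) s/x, so both s and p - 1 cancel against
  the denominator of the derivative of \<open>\<phi> p\<close>.\<close>

lemma phi_at_has_derivative_x:
  assumes "2 < p" "0 < x" "0 < z"
  shows "((\<lambda>t. phi_at p t z) has_real_derivative
    - (1 + phi_at p x z) * (phi_at p x z - p + 2) / ((phi_at p x z - p + 3) * x)) (at x)"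
proof -
  define s where "s = x powr (1 - p) * z"
  have s: "0 < s"
    using assms by (simp add: s_def)
  have pw: "x powr (1 - p - 1) = x powr (1 - p) / x"
    using powr_diff[of x "1 - p" 1] assms(2) by simp
  have "((\<lambda>t. t powr (1 - p) * z) has_real_derivative (1 - p) * (x powr (1 - p) / x) * z) (at x)"
    using has_real_derivative_powr[OF assms(2), of "1 - p"] unfolding pw by (rule DERIV_cmult_right)
  also have "(1 - p) * (x powr (1 - p) / x) * z = (1 - p) * s / x"
    by (simp add: s_def)
  finally have "((\<lambda>t. t powr (1 - p) * z) has_real_derivative (1 - p) * s / x) (at x)" .
  from DERIV_chain2[OF phi_has_derivative[OF assms(1) s, unfolded s_def] this]
  have "((\<lambda>t. phi_at p t z) has_real_derivative
    (1 + \<phi> p s) * (\<phi> p s - p + 2) / ((p - 1) * (\<phi> p s - p + 3)) / s * ((1 - p) * s / x)) (at x)"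
    by (simp only: s_def)
  \<comment> \<open>Generalised over \<open>a\<close> and \<open>b\<close> to keep the arithmetic
    free of \<open>\<phi>\<close>; for \<open>b = 0\<close> both sides are zero.\<close>
  moreover have "a / ((p - 1) * b) / s * ((1 - p) * s / x) = - a / (b * x)" for a b
    using s assms by (cases "b = 0") (simp_all add: field_simps)
  ultimately show ?thesis
    by (simp only: s_def mult_minus_left)
qed

lemma phi_at_has_derivative_z:
  assumes "2 < p" "0 < x" "0 < z"
  shows "((\<lambda>t. phi_at p x t) has_real_derivative
    (1 + phi_at p x z) * (phi_at p x z - p + 2) / ((p - 1) * (phi_at p x z - p + 3) * z)) (at z)"
proof -
  define s where "s = x powr (1 - p) * z"
  have s: "0 < s"
    using assms by (simp add: s_def)
  have "((\<lambda>t. x powr (1 - p) * t) has_real_derivative s / z) (at z)"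
    using assms unfolding s_def by (auto intro!: derivative_eq_intros)
  from DERIV_chain2[OF phi_has_derivative[OF assms(1) s, unfolded s_def] this]
  have "((\<lambda>t. phi_at p x t) has_real_derivative
    (1 + \<phi> p s) * (\<phi> p s - p + 2) / ((p - 1) * (\<phi> p s - p + 3)) / s * (s / z)) (at z)"
    by (simp only: s_def)
  moreover have "(1 + \<phi> p s) * (\<phi> p s - p + 2) / ((p - 1) * (\<phi> p s - p + 3)) / s * (s / z)
      = (1 + \<phi> p s) * (\<phi> p s - p + 2) / ((p - 1) * (\<phi> p s - p + 3) * z)"
    using s by simp
  ultimately show ?thesis
    by (simp only: s_def)
qed

section \<open>First partial derivatives of \<open>B\<close>\<close>

text \<open>With w = f x - p + 2 the derivative is d (1 - 1/w^2), and 1 - 1/w^2 = (w - 1)(w +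
  1)/w^2. The factored form exposes w + 1, which cancels in the denominators of the derivatives of
  \<open>phi_at\<close>.\<close>

lemma add_inverse_has_derivative:
  fixes f :: "real \<Rightarrow> real"
  assumes "(f has_real_derivative d) (at x)" "f x - p + 2 \<noteq> 0"
  shows "((\<lambda>t. f t + 1 / (f t - p + 2)) has_real_derivative
    d * (f x - p + 1) * (f x - p + 3) / (f x - p + 2)\<^sup>2) (at x)"
proof -
  have "d + - d / (f x - p + 2)\<^sup>2 = d * ((f x - p + 2)\<^sup>2 - 1) / (f x - p + 2)\<^sup>2"
    using assms(2) by (simp add: field_simps)
  also have "(f x - p + 2)\<^sup>2 - 1 = (f x - p + 1) * (f x - p + 3)"
    by (simp add: power2_eq_square algebra_simps)
  finally have "d + - d / (f x - p + 2)\<^sup>2 = d * (f x - p + 1) * (f x - p + 3) / (f x - p + 2)\<^sup>2"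
    by (simp add: mult.assoc)
  moreover have "((\<lambda>t. f t + 1 / (f t - p + 2)) has_real_derivative d + - d / (f x - p + 2)\<^sup>2) (at x)"
    using assms(2) by (auto intro!: derivative_eq_intros assms(1) simp: power2_eq_square)
  ultimately show ?thesis
    by simp
qed

lemma B_has_derivative_x:
  assumes "2 < p" "0 < x" "0 < z"
  shows "((\<lambda>t. B p t z) has_real_derivative (p - 1) * z / (phi_at p x z - p + 2)) (at x)"
proof -
  define u where "u = phi_at p x z"
  define w where "w = u - p + 2"
  have w: "0 < w" and u: "u = w + p - 2"
    using phi_at_gt[OF assms] by (auto simp: w_def u_def)
  define d where "d = - (1 + u) * w / ((u - p + 3) * x) * (u - p + 1) * (u - p + 3) / w\<^sup>2"
  have d: "d = - ((w + p - 1) * (w - 1) / (w * x))"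
    using w assms(2) unfolding d_def u
    by (simp add: divide_simps power2_eq_square) (simp add: algebra_simps)
  have "((\<lambda>t. (1 - 1 / p) * t * z) has_real_derivative (1 - 1 / p) * z) (at x)"
    by (auto intro!: derivative_eq_intros)
  from DERIV_mult[OF this add_inverse_has_derivative[OF phi_at_has_derivative_x[OF assms], of p]]
  have "((\<lambda>t. B p t z) has_real_derivative
      (1 - 1 / p) * z * (u + 1 / w) + d * ((1 - 1 / p) * x * z)) (at x)"
    using w unfolding B_def d_def w_def u_def by simp
  also have "d * ((1 - 1 / p) * x * z) = - (1 - 1 / p) * z * ((w + p - 1) * (w - 1) / w)"
    using assms(2) w by (simp add: d divide_simps)
  also have "(1 - 1 / p) * z * (u + 1 / w) + - (1 - 1 / p) * z * ((w + p - 1) * (w - 1) / w)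
      = (1 - 1 / p) * z * (u + 1 / w - (w + p - 1) * (w - 1) / w)"
    by (simp only: mult_minus_left right_diff_distrib[of "(1 - 1 / p) * z"] add_uminus_conv_diff)
  \<comment> \<open>Over the denominator w the quadratic and linear terms cancel, leaving the
    constant p.\<close>
  also have "u + 1 / w - (w + p - 1) * (w - 1) / w = p / w"
    using w by (simp add: u divide_simps) (simp add: algebra_simps)
  also have "(1 - 1 / p) * z * (p / w) = (p - 1) * z / w"
    using assms w by (simp add: field_simps)
  finally show ?thesis
    by (simp add: w_def u_def)
qed

lemma B_has_derivative_z:
  assumes "2 < p" "0 < x" "0 < z"
  shows "((\<lambda>t. B p x t) has_real_derivative x * phi_at p x z) (at z)"
proof -
  define u where "u = phi_at p x z"
  define w where "w = u - p + 2"
  have w: "0 < w" and u: "u = w + p - 2"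
    using phi_at_gt[OF assms] by (auto simp: w_def u_def)
  define d where "d = (1 + u) * w / ((p - 1) * (u - p + 3) * z) * (u - p + 1) * (u - p + 3) / w\<^sup>2"
  have d: "d = (w + p - 1) * (w - 1) / ((p - 1) * w * z)"
    using w assms unfolding d_def u by (simp add: divide_simps power2_eq_square)
  have "((\<lambda>t. (1 - 1 / p) * x * t) has_real_derivative (1 - 1 / p) * x) (at z)"
    by (auto intro!: derivative_eq_intros)
  from DERIV_mult[OF this add_inverse_has_derivative[OF phi_at_has_derivative_z[OF assms], of p]]
  have "((\<lambda>t. B p x t) has_real_derivative
      (1 - 1 / p) * x * (u + 1 / w) + d * ((1 - 1 / p) * x * z)) (at z)"
    using w unfolding B_def d_def w_def u_def by simp
  also have "d * ((1 - 1 / p) * x * z) = (1 - 1 / p) * x * ((w + p - 1) * (w - 1) / ((p - 1) * w))"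
    using assms w by (simp add: d divide_simps)
  also have "(1 - 1 / p) * x * (u + 1 / w) + \<dots>
      = (1 - 1 / p) * x * (u + 1 / w + (w + p - 1) * (w - 1) / ((p - 1) * w))"
    by (simp add: algebra_simps)
  \<comment> \<open>Over the denominator (p - 1) w the constant terms cancel and the numerator
    becomes p w (w + p - 2) = p w u.\<close>
  also have "u + 1 / w + (w + p - 1) * (w - 1) / ((p - 1) * w) = p / (p - 1) * u"
    using w assms(1) by (simp add: u divide_simps) (simp add: algebra_simps)
  also have "(1 - 1 / p) * x * (p / (p - 1) * u) = x * u"
    using assms(1) by (simp add: field_simps)
  finally show ?thesis
    by (simp add: u_def)
qed

lemma B_x_eq:
  assumes "2 < p" "0 < x" "0 < z"
  shows "B_x p x z = (p - 1) * z / (phi_at p x z - p + 2)"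
  using B_has_derivative_x[OF assms] by (simp add: B_x_def partial_x_def DERIV_imp_deriv)

lemma B_z_eq:
  assumes "2 < p" "0 < x" "0 < z"
  shows "B_z p x z = x * phi_at p x z"
  using B_has_derivative_z[OF assms] by (simp add: B_z_def partial_z_def DERIV_imp_deriv)

section \<open>Second partial derivatives of \<open>B\<close>\<close>

text \<open>The formulas for \<open>B_x\<close> and \<open>B_z\<close> are available only on the
  open quadrant, which is enough for differentiating them once more.\<close>

lemma deriv_eqI_pos:
  fixes f g :: "real \<Rightarrow> real"
  assumes "(f has_real_derivative d) (at x)" "0 < x" "\<And>t. 0 < t \<Longrightarrow> f t = g t"
  shows "deriv g x = d"
  using has_field_derivative_transform_within_open[OF assms(1), of "{0<..}" g] assms(2,3)
  by (auto intro: DERIV_imp_deriv)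

lemma B_xx_eq:
  assumes "2 < p" "0 < x" "0 < z"
  shows "B_xx p x z = (p - 1) * z * (1 + phi_at p x z)
    / (x * (phi_at p x z - p + 2) * (phi_at p x z - p + 3))"
  unfolding B_xx_def partial_x_def
proof (rule deriv_eqI_pos)
  define d where "d = - (1 + phi_at p x z) * (phi_at p x z - p + 2) / ((phi_at p x z - p + 3) * x)"
  define w where "w = phi_at p x z - p + 2"
  have w: "0 < w"
    using phi_at_gt[OF assms] by (auto simp: w_def)
  have "((\<lambda>t. phi_at p t z - p + 2) has_real_derivative d) (at x)"
    using phi_at_has_derivative_x[OF assms] unfolding d_def
    by (auto intro!: derivative_eq_intros)
  from DERIV_divide[OF DERIV_const this, of "(p - 1) * z"]
  have "((\<lambda>t. (p - 1) * z / (phi_at p t z - p + 2)) has_real_derivative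
      - ((p - 1) * z * d) / (w * w)) (at x)"
    using w by (simp add: w_def)
  moreover have eq: "- ((p - 1) * z * (- a * w / (b * x))) / (w * w) = (p - 1) * z * a / (x * w * b)" for a b
    using w by (simp add: mult_ac)
  ultimately show "((\<lambda>t. (p - 1) * z / (phi_at p t z - p + 2)) has_real_derivative
      (p - 1) * z * (1 + phi_at p x z)
        / (x * (phi_at p x z - p + 2) * (phi_at p x z - p + 3))) (at x)"
    unfolding d_def w_def[symmetric] eq by simp
qed (use assms B_x_eq in auto)

lemma B_xz_eq:
  assumes "2 < p" "0 < x" "0 < z"
  shows "B_xz p x z = (p - 2) / (phi_at p x z - p + 3)"
  unfolding B_xz_def partial_z_def
proof (rule deriv_eqI_pos)
  define d where "d = (1 + phi_at p x z) * (phi_at p x z - p + 2) / ((p - 1) * (phi_at p x z - p + 3) * z)"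
  define w where "w = phi_at p x z - p + 2"
  have w: "0 < w" and u: "phi_at p x z = w + p - 2"
    using phi_at_gt[OF assms] by (auto simp: w_def)
  have "((\<lambda>t. phi_at p x t - p + 2) has_real_derivative d) (at z)"
    using phi_at_has_derivative_z[OF assms] unfolding d_def
    by (auto intro!: derivative_eq_intros)
  from DERIV_divide[OF DERIV_cmult_Id this, of "p - 1"]
  have "((\<lambda>t. (p - 1) * t / (phi_at p x t - p + 2)) has_real_derivative
      ((p - 1) * w - (p - 1) * z * d) / (w * w)) (at z)"
    using w by (simp add: w_def)
  moreover have "(p - 1) * z * d = (w + p - 1) * w / (w + 1)"
    using assms w unfolding d_def u by (simp add: divide_simps)
  \<comment> \<open>Over the denominator w + 1 the numerator is w ((p - 1)(w + 1) - (w + p - 1)) =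
    (p - 2) w^2.\<close>
  moreover have "((p - 1) * w - (w + p - 1) * w / (w + 1)) / (w * w) = (p - 2) / (w + 1)"
    using w by (simp add: divide_simps) (simp add: algebra_simps)
  moreover have "w + 1 = phi_at p x z - p + 3"
    by (simp add: w_def)
  ultimately show "((\<lambda>t. (p - 1) * t / (phi_at p x t - p + 2)) has_real_derivative
      (p - 2) / (phi_at p x z - p + 3)) (at z)"
    by simp
qed (use assms B_x_eq in auto)

lemma B_zz_eq:
  assumes "2 < p" "0 < x" "0 < z"
  shows "B_zz p x z = x * ((1 + phi_at p x z) * (phi_at p x z - p + 2))
    / ((p - 1) * (phi_at p x z - p + 3) * z)"
  unfolding B_zz_def partial_z_def
proof (rule deriv_eqI_pos)
  show "((\<lambda>t. x * phi_at p x t) has_real_derivative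
      x * ((1 + phi_at p x z) * (phi_at p x z - p + 2))
        / ((p - 1) * (phi_at p x z - p + 3) * z)) (at z)"
    using DERIV_cmult[OF phi_at_has_derivative_z[OF assms], of x] by simp
qed (use assms B_z_eq in auto)

section \<open>The lower bound of condition 1\<close>

lemma B_ge:
  assumes "2 < p" "0 < x" "0 < z"
  shows "x * z \<le> B p x z"
proof -
  define w where "w = phi_at p x z - p + 2"
  have u: "phi_at p x z = w + p - 2" and w: "0 < w"
    using phi_at_gt[OF assms] by (auto simp: w_def)
  \<comment> \<open>Expanding gives w - 2 + 1/w, so the bracket w + p - 2 + 1/w of \<open>B\<close>
    is at least p.\<close>
  have "0 \<le> (w - 1)\<^sup>2 / w"
    using w by simp
  then have "p \<le> w + p - 2 + 1 / w"
    using w by (simp add: power2_eq_square field_simps)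
  then have "(1 - 1 / p) * p \<le> (1 - 1 / p) * (w + p - 2 + 1 / w)"
    using assms by (intro mult_left_mono) auto
  \<comment> \<open>Here (1 - 1/p) p = p - 1, and p - 1 > 1 is weakened to 1.\<close>
  then have "1 \<le> (1 - 1 / p) * (w + p - 2 + 1 / w)"
    using assms by (simp add: left_diff_distrib)
  then have "x * z * 1 \<le> x * z * ((1 - 1 / p) * (w + p - 2 + 1 / w))"
    using assms by (intro mult_left_mono) auto
  also have "\<dots> = B p x z"
    unfolding B_def u by simp
  finally show ?thesis
    by simp
qed

section \<open>The upper bound of condition 2\<close>

text \<open>At u = p - 1 the last factor is 1 and the powers of p cancel. This is the point where
  \<open>\<phi> p s\<close> meets \<open>s powr (1 / (p - 1))\<close>.\<close>

lemma phi_inv_p_minus_1: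
  assumes "2 < p"
  shows "phi_inv p (p - 1) = (p - 1) powr (p - 1)"
proof -
  have "(1 - 1 / p) powr (p - 1) = (p - 1) powr (p - 1) / p powr (p - 1)"
    using assms by (simp add: powr_divide[symmetric] diff_divide_distrib)
  moreover have "p powr (p - 1) = p * p powr (p - 2)"
    using assms powr_mult_base[of p "p - 2"] by simp
  ultimately show ?thesis
    using assms by (simp add: phi_inv_def)
qed

text \<open>The difference is the logarithm of \<open>phi_inv p u / u powr (p - 1)\<close>. It
  vanishes at u = p - 1, so monotonicity decides on each side of that point how
  \<open>\<phi> p s\<close> compares with \<open>s powr (1 / (p - 1))\<close>.\<close>

lemma ln_phi_inv_diff_mono:
  assumes "2 < p" "p - 2 < u" "u \<le> v"
  shows "ln (phi_inv p u) - (p - 1) * ln u \<le> ln (phi_inv p v) - (p - 1) * ln v"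
proof (rule DERIV_nonneg_imp_nondecreasing[OF assms(3)])
  fix t assume "u \<le> t" "t \<le> v"
  then have t: "p - 2 < t"
    using assms by simp
  have "((\<lambda>t. ln (phi_inv p t)) has_real_derivative
      (p - 1) * (t - p + 3) / ((1 + t) * (t - p + 2))) (at t)"
    using DERIV_chain2[OF DERIV_ln_divide[OF phi_inv_pos[OF assms(1) t]] phi_inv_has_derivative[OF assms(1) t]]
      phi_inv_pos[OF assms(1) t] by simp
  from DERIV_diff[OF this DERIV_cmult[OF DERIV_ln_divide, of t "p - 1"]]
  have "((\<lambda>t. ln (phi_inv p t) - (p - 1) * ln t) has_real_derivative
      (p - 1) * (t - p + 3) / ((1 + t) * (t - p + 2)) - (p - 1) / t) (at t)"
    using assms(1) t by simp
  \<comment> \<open>Only a constant survives: t (t - p + 3) - (1 + t)(t - p + 2) = p - 2.\<close>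
  also have "(p - 1) * (t - p + 3) / ((1 + t) * (t - p + 2)) - (p - 1) / t
      = (p - 1) * (p - 2) / (t * (1 + t) * (t - p + 2))"
    using assms(1) t by (simp add: divide_simps) (simp add: algebra_simps)
  finally have "((\<lambda>t. ln (phi_inv p t) - (p - 1) * ln t) has_real_derivative
      (p - 1) * (p - 2) / (t * (1 + t) * (t - p + 2))) (at t)" .
  moreover have "0 \<le> (p - 1) * (p - 2) / (t * (1 + t) * (t - p + 2))"
    using assms t by simp
  ultimately show "\<exists>y. ((\<lambda>t. ln (phi_inv p t) - (p - 1) * ln t) has_real_derivative y) (at t) \<and> 0 \<le> y"
    by blast
qed

lemma root_le_phi:
  assumes "2 < p" "0 < s" "s \<le> (p - 1) powr (p - 1)"
  shows "s powr (1 / (p - 1)) \<le> \<phi> p s"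
proof -
  have u: "p - 2 < \<phi> p s" "phi_inv p (\<phi> p s) = s" "\<phi> p s \<le> p - 1"
    using assms phi_gt phi_inv_phi phi_le_iff[of p s "p - 1"] phi_inv_p_minus_1 by auto
  \<comment> \<open>Monotonicity from \<open>\<phi> p s\<close> up to \<open>p - 1\<close>, where
    the difference is \<open>ln ((p - 1) powr (p - 1)) - (p - 1) * ln (p - 1) = 0\<close>.\<close>
  have "ln s \<le> (p - 1) * ln (\<phi> p s)"
    using ln_phi_inv_diff_mono[OF assms(1) u(1,3)] u assms(1) by (simp add: phi_inv_p_minus_1 ln_powr)
  then have "ln (s powr (1 / (p - 1))) \<le> ln (\<phi> p s)"
    using assms by (simp add: ln_powr field_simps)
  then show ?thesis
    by (subst (asm) ln_le_cancel_iff) (use assms u in auto)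
qed

lemma phi_le_root:
  assumes "2 < p" "(p - 1) powr (p - 1) \<le> s"
  shows "\<phi> p s \<le> s powr (1 / (p - 1))"
proof -
  have "0 < (p - 1) powr (p - 1)"
    using assms by simp
  then have s: "0 < s"
    using assms by linarith
  have u: "p - 2 < \<phi> p s" "phi_inv p (\<phi> p s) = s"
    using assms s phi_gt phi_inv_phi by auto
  have "p - 1 \<le> \<phi> p s"
    using phi_inv_less_iff[of p "\<phi> p s" "p - 1"] u assms phi_inv_p_minus_1[of p] by auto
  \<comment> \<open>Now \<open>p - 1\<close> is the left end of the comparison, so the difference is
    nonnegative at \<open>\<phi> p s\<close>.\<close>
  from ln_phi_inv_diff_mono[OF assms(1) _ this] have "(p - 1) * ln (\<phi> p s) \<le> ln s"
    using u assms(1) by (simp add: phi_inv_p_minus_1 ln_powr)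
  then have "ln (\<phi> p s) \<le> ln (s powr (1 / (p - 1)))"
    using assms s by (simp add: ln_powr field_simps)
  then show ?thesis
    by (subst (asm) ln_le_cancel_iff) (use assms u s in auto)
qed

lemma B_1_le:
  assumes "2 < p" "0 < s"
  shows "B p 1 s \<le> (p - 1) powr p / p + s powr (p / (p - 1)) / (p / (p - 1))"
proof -
  \<comment> \<open>The constant \<open>(p - 1) powr p / p\<close> is left out, so the goal is that
    \<open>f\<close> is at least its negative, which is the value of \<open>f\<close> at its minimum
    point \<open>a\<close>.\<close>
  define f where "f = (\<lambda>s. s powr (p / (p - 1)) / (p / (p - 1)) - B p 1 s)"
  define a where "a = (p - 1) powr (p - 1)"
  have a: "0 < a"
    using assms by (simp add: a_def)
  have f': "(f has_real_derivative t powr (1 / (p - 1)) - \<phi> p t) (at t)" if "0 < t" for t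
  proof -
    have e: "p / (p - 1) - 1 = 1 / (p - 1)"
      using assms by (simp add: field_simps)
    have "((\<lambda>s. s powr (p / (p - 1))) has_real_derivative p / (p - 1) * t powr (1 / (p - 1))) (at t)"
      using has_real_derivative_powr[OF that, of "p / (p - 1)"] by (simp add: e)
    from DERIV_diff[OF DERIV_cdivide[OF this, of "p / (p - 1)"]
        B_has_derivative_z[OF assms(1) zero_less_one that]]
    show ?thesis
      using assms by (simp add: f_def)
  qed
  have "f a \<le> f s"
  proof (cases "s \<le> a")
    case True
    then show ?thesis
    proof (rule DERIV_nonpos_imp_nonincreasing)
      fix t assume "s \<le> t" "t \<le> a"
      then show "\<exists>y. (f has_real_derivative y) (at t) \<and> y \<le> 0"
        using f'[of t] root_le_phi[of p t] assms a
        by (intro exI[of _ "t powr (1 / (p - 1)) - \<phi> p t"] conjI) (auto simp: a_def[symmetric])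
    qed
  next
    case False
    then have "a \<le> s"
      by simp
    then show ?thesis
    proof (rule DERIV_nonneg_imp_nondecreasing)
      fix t assume "a \<le> t" "t \<le> s"
      then show "\<exists>y. (f has_real_derivative y) (at t) \<and> 0 \<le> y"
        using f'[of t] phi_le_root[of p t] assms a
        by (intro exI[of _ "t powr (1 / (p - 1)) - \<phi> p t"] conjI) (auto simp: a_def[symmetric])
    qed
  qed
  moreover have "f a = - ((p - 1) powr p / p)"
  proof -
    have pa: "\<phi> p a = p - 1"
      using phi_phi_inv[of p "p - 1"] assms by (simp add: phi_inv_p_minus_1 a_def)
    have a_powr: "a powr (p / (p - 1)) = (p - 1) * a" "(p - 1) powr p = (p - 1) * a"
      using assms powr_mult_base[of "p - 1" "p - 1"] by (auto simp: a_def powr_powr)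
    \<comment> \<open>Here u = p - 1 and w = 1, so the bracket in \<open>B p 1 a\<close> equals
      p.\<close>
    have "f a = (p - 1) * a / (p / (p - 1)) - (1 - 1 / p) * a * p"
      by (simp add: f_def B_def pa a_powr)
    also have "\<dots> = - ((p - 1) * a / p)"
      using assms by (simp add: field_simps)
    finally show ?thesis
      by (simp add: a_powr)
  qed
  ultimately show ?thesis
    by (simp add: f_def)
qed

text \<open>Passing from (x, z) to (1, s) leaves the argument of \<open>\<phi>\<close> unchanged,
  and x z = x^p s. Hence \<open>B p x z = x powr p * B p 1 s\<close>, and the case x = 1
  applies.\<close>

lemma B_le:
  assumes "2 < p" "0 < x" "0 < z"
  shows "B p x z \<le> (p - 1) powr p * x powr p / p + z powr (p / (p - 1)) / (p / (p - 1))"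
proof -
  define s where "s = x powr (1 - p) * z"
  have s: "0 < s"
    using assms by (simp add: s_def)
  have "x powr p * x powr (1 - p) = x"
    using assms by (simp add: powr_add[symmetric])
  then have "x * z = x powr p * s"
    by (simp add: s_def flip: mult.assoc)
  moreover have "B p x z = (x * z) * ((1 - 1 / p) * (\<phi> p s + 1 / (\<phi> p s - p + 2)))"
    unfolding B_def s_def by simp
  ultimately have "B p x z = x powr p * B p 1 s"
    by (simp add: B_def)
  also have "\<dots> \<le> x powr p * ((p - 1) powr p / p + s powr (p / (p - 1)) / (p / (p - 1)))"
    using B_1_le[OF assms(1) s] by (intro mult_left_mono) auto
  \<comment> \<open>Raising s to the power p/(p - 1) gives x the exponent -p, which cancels
    x^p.\<close>
  also have "x powr p * s powr (p / (p - 1)) = z powr (p / (p - 1))"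
  proof -
    have "(1 - p) * (p / (p - 1)) = - p"
      using assms by (simp add: field_simps)
    then have "s powr (p / (p - 1)) = x powr (- p) * z powr (p / (p - 1))"
      using assms by (simp add: s_def powr_mult powr_powr)
    then show ?thesis
      using assms by (simp add: powr_minus)
  qed
  then have "x powr p * ((p - 1) powr p / p + s powr (p / (p - 1)) / (p / (p - 1)))
      = (p - 1) powr p * x powr p / p + z powr (p / (p - 1)) / (p / (p - 1))"
    by (simp only: distrib_left times_divide_eq_right mult.commute)
  finally show ?thesis .
qed

section \<open>Conditions 3 and 4 on the second derivatives\<close>

text \<open>Since p > 2, \<open>B_xz\<close> is positive. The resulting quotient q is a common
  factor: B_xx = q (p - 1) z/(x w) and B_zz = q x w/((p - 1) z), where w is
  \<open>phi_at p x z - p + 2\<close>.\<close>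

lemma abs_B_xz_plus_1:
  assumes "2 < p" "0 < x" "0 < z"
  shows "\<bar>B_xz p x z\<bar> + 1 = (1 + phi_at p x z) / (phi_at p x z - p + 3)"
  using assms phi_at_gt[OF assms] by (simp add: B_xz_eq field_simps)

lemma B_xx_le:
  assumes "2 < p" "0 < x" "0 < z"
  shows "B_xx p x z / (\<bar>B_xz p x z\<bar> + 1) \<le> B_x p x z / x"
proof -
  have "(p - 1) * z * a / (x * w * b) / (a / b) = (p - 1) * z / w / x" if "0 < a" "0 < b" for a b w
    using that by (simp add: mult_ac)
  then show ?thesis
    using assms phi_at_gt[OF assms] unfolding abs_B_xz_plus_1[OF assms]
    by (simp add: B_xx_eq B_x_eq mult.commute)
qed

text \<open>Once the common quotient is divided out, (u - p + 2)/(p - 1) stands in place of u;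
  subtracting p - 2 and dividing by p - 1 > 1 only decrease it.\<close>

lemma B_zz_le:
  assumes "2 < p" "0 < x" "0 < z"
  shows "B_zz p x z / (\<bar>B_xz p x z\<bar> + 1) \<le> B_z p x z / z"
proof -
  define u where "u = phi_at p x z"
  have u: "p - 2 < u"
    using phi_at_gt[OF assms] by (simp add: u_def)
  have "B_zz p x z / (\<bar>B_xz p x z\<bar> + 1) = (u - p + 2) / (p - 1) * (x / z)"
  proof -
    have "x * (a * w) / ((p - 1) * b * z) / (a / b) = w / (p - 1) * (x / z)" if "0 < a" "0 < b" for a b w
      using that by (simp add: mult_ac)
    from this[of "1 + u" "u - p + 3"] show ?thesis
      using assms(1) u unfolding abs_B_xz_plus_1[OF assms] B_zz_eq[OF assms] u_def by auto
  qed
  also have "\<dots> \<le> u * (x / z)"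
  proof (rule mult_right_mono)
    have "u - p + 2 \<le> u * 1"
      using assms by simp
    also have "\<dots> \<le> u * (p - 1)"
      using assms u by (intro mult_left_mono) auto
    finally show "(u - p + 2) / (p - 1) \<le> u"
      using assms by (simp add: divide_le_eq)
  qed (use assms in auto)
  also have "\<dots> = B_z p x z / z"
    using assms by (simp add: B_z_eq u_def)
  finally show ?thesis .
qed

text \<open>The square of sqrt a |h| - sqrt c |k| gives a h^2 + c k^2 >= 2 (|b| + 1) |h| |k|, and
  the mixed term 2 b h k loses at most 2 |b| |h| |k| of this.\<close>

lemma quadratic_form_ge:
  fixes a b c h k :: real
  assumes "0 \<le> a" "0 \<le> c" "a * c = (\<bar>b\<bar> + 1)\<^sup>2"
  shows "2 * \<bar>h\<bar> * \<bar>k\<bar> \<le> a * h\<^sup>2 + 2 * b * h * k + c * k\<^sup>2"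
proof -
  have "sqrt a * sqrt c = \<bar>b\<bar> + 1"
    by (simp add: real_sqrt_mult[symmetric] assms(3))
  moreover have "(sqrt a * \<bar>h\<bar> - sqrt c * \<bar>k\<bar>)\<^sup>2
      = a * h\<^sup>2 + c * k\<^sup>2 - 2 * (sqrt a * sqrt c) * (\<bar>h\<bar> * \<bar>k\<bar>)"
    using assms(1,2) by (simp add: power2_diff power_mult_distrib mult_ac)
  moreover have "0 \<le> (sqrt a * \<bar>h\<bar> - sqrt c * \<bar>k\<bar>)\<^sup>2"
    by simp
  ultimately have "2 * (\<bar>b\<bar> + 1) * (\<bar>h\<bar> * \<bar>k\<bar>) \<le> a * h\<^sup>2 + c * k\<^sup>2"
    by simp
  moreover have "- (\<bar>b\<bar> * (\<bar>h\<bar> * \<bar>k\<bar>)) \<le> b * h * k"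
    using abs_ge_minus_self[of "b * h * k"] by (simp add: abs_mult mult_ac)
  ultimately show ?thesis
    by (simp add: algebra_simps)
qed

lemma B_hessian_ge:
  assumes "2 < p" "0 < x" "0 < z"
  shows "2 * \<bar>h\<bar> * \<bar>k\<bar> \<le> B_xx p x z * h\<^sup>2 + 2 * B_xz p x z * h * k + B_zz p x z * k\<^sup>2"
proof (rule quadratic_form_ge)
  note u = phi_at_gt[OF assms]
  show "0 \<le> B_xx p x z" "0 \<le> B_zz p x z"
    using assms u by (simp_all add: B_xx_eq B_zz_eq)
  \<comment> \<open>The cofactors of the quotient from \<open>abs_B_xz_plus_1\<close> in
    \<open>B_xx\<close> and \<open>B_zz\<close> are reciprocal, so only its square is left.\<close>
  show "B_xx p x z * B_zz p x z = (\<bar>B_xz p x z\<bar> + 1)\<^sup>2"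
    using assms u unfolding abs_B_xz_plus_1[OF assms]
    by (simp add: B_xx_eq B_zz_eq power2_eq_square divide_simps)
qed

theorem theorem3p2:
  fixes p p' K :: real
  assumes "2 < p" and "p' = p / (p - 1)" and "K = (p - 1) powr p"
  shows "(\<forall>x>0. \<forall>z>0. B p x z \<ge> x * z) \<and>
    (\<forall>x>0. \<forall>z>0. B p x z \<le> K * x powr p / p + z powr p' / p') \<and>
    (\<forall>x>0. \<forall>z>0.
       B_xx p x z / (\<bar>B_xz p x z\<bar> + 1) \<le> B_x p x z / x \<and>
       B_zz p x z / (\<bar>B_xz p x z\<bar> + 1) \<le> B_z p x z / z) \<and>
    (\<forall>x>0. \<forall>z>0. \<forall>h k.
       B_xx p x z * h\<^sup>2 + 2 * B_xz p x z * h * k + B_zz p x z * k\<^sup>2 \<ge> 2 * \<bar>h\<bar> * \<bar>k\<bar>)"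
  unfolding assms(2,3)
  by (intro conjI allI impI B_ge B_le B_xx_le B_zz_le B_hessian_ge assms(1))

end
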